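(* Let $\lambda$ be the solution of the spatial coagulation equation described in the context, and assume the moment-control conditions (A1) and (A2) stated there. For every $t$ such that $M_2(t)\in(0,\infty)$, define $$p_t(x)=\frac{m_2(x,t)}{M_2(t)},\qquad x\in\mathcal S.$$ Then $M_2$ satisfies $$\frac{d}{dt}M_2(t)=\alpha(t)\,M_2(t)^2,\qquad\text{where}\qquad \alpha(t)=\sum_{x,y\in\mathcal S}G(x,y)p_t(x)p_t(y).$$ Therefore the gelation time is given by $$t_{\mathrm{gel}}=\inf\Bigl\{t>0:\ \int_0^t\alpha(s)\,ds=M_2(0)^{-1}\Bigr\}$$ (with $\inf\emptyset=+\infty$).
   Context: Setting. $\mathcal S$ is a finite or countably infinite set, and $G:\mathcal S\times\mathcal S\to(0,\infty)$ is a uniformly bounded function (the spatial kernel). $\mathbb N=\{1,2,\dots\}$. One considers densities $\lambda_t(i,x)\ge0$, $i\in\mathbb N$, $x\in\mathcal S$, solving $$\frac{d}{dt}\lambda_t(i,x)=\sum_{y\in\mathcal S}\sum_{j=1}^{i-1}\frac{j}{i}\,j(i-j)\,G(x,y)\lambda_t(j,x)\lambda_t(i-j,y)-i\,\lambda_t(i,x)\sum_{y\in\mathcal S}\sum_{j\ge1}j\,G(x,y)\lambda_t(j,y),$$ with monodisperse normalised initial condition: $\sum_{i\ge1}i\lambda_0(i,x)=\lambda_0(1,x)$ for every $x$ (so $\lambda_0(i,x)=0$ for $i\ge2$) and $\sum_{x\in\mathcal S}\lambda_0(1,x)=1$. Moments: $m_k(x,t)=\sum_{i\ge1}i^k\lambda_t(i,x)$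 and $M_k(t)=\sum_{x\in\mathcal S}m_k(x,t)$, $k\in\mathbb N$. Gelation time: $t_{\mathrm{gel}}=\sup\{t>0: M_2(t)<\infty\}\in(0,\infty]$. The solution $\lambda$ is the (unique) solution up to the gelation time, i.e. on $[0,t_{\mathrm{gel}})$, with $M_2$ bounded on compact subintervals of $[0,t_{\mathrm{gel}})$, and, if $t_{\mathrm{gel}}<\infty$, $M_2(t)\to\infty$ as $t\uparrow t_{\mathrm{gel}}$; this is a standing fact about the solution. The function $\alpha$ is defined on $[0,t_{\mathrm{gel}})$, so the integral $\int_0^t\alpha(s)\,ds$ is considered for $t\le t_{\mathrm{gel}}$, $t<\infty$. Moment-control conditions. There is $T_1>0$ (with $[0,T_1)$ contained in the interval $[0,t_{\mathrm{gel}})$ of existence) such that: (A1) for every $x\in\mathcal S$ the series $\sum_{y\in\mathcal S}G(x,y)m_2(x,t)m_1(y,t)$ converges uniformly in $t\in[0,T_1)$; (A2) for every $x\in\mathcal S$ the series $\sum_{y\in\mathcal S}G(x,y)m_2(x,t)m_2(y,t)$ converges uniformly in $t\in[0,T_1)$. *)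

theory Defs
  imports "HOL-Analysis.Analysis"
begin

text \<open>
  A family of densities is a function \<open>lam t i x\<close> of the time \<open>t\<close>, the mass \<open>i \<ge> 1\<close> and the site
  \<open>x \<in> S\<close>; values at \<open>i = 0\<close>, at \<open>t < 0\<close> and at \<open>x \<notin> S\<close> are never used.
\<close>

definition bounded_kernel :: "'s set \<Rightarrow> ('s \<Rightarrow> 's \<Rightarrow> real) \<Rightarrow> bool" where
  "bounded_kernel S G \<longleftrightarrow>
     (\<forall>x\<in>S. \<forall>y\<in>S. 0 < G x y) \<and> (\<exists>C. \<forall>x\<in>S. \<forall>y\<in>S. G x y \<le> C)"

definition site_moment :: "(real \<Rightarrow> nat \<Rightarrow> 's \<Rightarrow> real) \<Rightarrow> nat \<Rightarrow> 's \<Rightarrow> real \<Rightarrow> ennreal" where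
  "site_moment lam k x t = (\<Sum>\<^sub>\<infinity>i\<in>{1..}. ennreal (real i ^ k * lam t i x))"

definition total_moment :: "'s set \<Rightarrow> (real \<Rightarrow> nat \<Rightarrow> 's \<Rightarrow> real) \<Rightarrow> nat \<Rightarrow> real \<Rightarrow> ennreal" where
  "total_moment S lam k t = (\<Sum>\<^sub>\<infinity>x\<in>S. site_moment lam k x t)"

text \<open>
  Solutions are only considered before gelation. Since \<open>lam\<close> is a total function of time, the
  following supremum means that \<open>lam\<close> is extended past the gelation time by arbitrary values with
  infinite second moment.
\<close>

definition gel_time :: "'s set \<Rightarrow> (real \<Rightarrow> nat \<Rightarrow> 's \<Rightarrow> real) \<Rightarrow> ereal" where
  "gel_time S lam = Sup {ereal t | t. 0 < t \<and> total_moment S lam 2 t < \<infinity>}"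

definition coag_rhs ::
  "'s set \<Rightarrow> ('s \<Rightarrow> 's \<Rightarrow> real) \<Rightarrow> (real \<Rightarrow> nat \<Rightarrow> 's \<Rightarrow> real) \<Rightarrow> real \<Rightarrow> nat \<Rightarrow> 's \<Rightarrow> real" where
  "coag_rhs S G lam t i x =
     (\<Sum>\<^sub>\<infinity>y\<in>S. \<Sum>j = 1..<i.
        (real j / real i) * (real j * real (i - j)) * G x y * lam t j x * lam t (i - j) y)
     - real i * lam t i x * (\<Sum>\<^sub>\<infinity>y\<in>S. \<Sum>\<^sub>\<infinity>j\<in>{1..}. real j * G x y * lam t j y)"

text \<open>
  The real-valued infinite sums in \<open>coag_rhs\<close> converge before gelation, because \<open>G\<close> is bounded and
  the first moment is at most the second one, which is finite there. At \<open>t = 0\<close> the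
  derivative is one-sided.
\<close>

definition coag_solution ::
  "'s set \<Rightarrow> ('s \<Rightarrow> 's \<Rightarrow> real) \<Rightarrow> (real \<Rightarrow> nat \<Rightarrow> 's \<Rightarrow> real) \<Rightarrow> bool" where
  "coag_solution S G lam \<longleftrightarrow>
     0 < gel_time S lam \<and>
     (\<forall>t\<ge>0. ereal t < gel_time S lam \<longrightarrow>
        (\<forall>i\<ge>1. \<forall>x\<in>S. 0 \<le> lam t i x \<and>
           ((\<lambda>s. lam s i x) has_real_derivative coag_rhs S G lam t i x) (at t within {0..}))) \<and>
     (\<forall>T\<ge>0. ereal T < gel_time S lam \<longrightarrow>
        (\<exists>B::real. \<forall>t\<in>{0..T}. total_moment S lam 2 t \<le> ennreal B)) \<and>
     (\<forall>T::real. gel_time S lam = ereal T \<longrightarrow>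
        ((\<lambda>t. total_moment S lam 2 t) \<longlongrightarrow> \<infinity>) (at_left T))"

definition monodisperse_initial :: "'s set \<Rightarrow> (real \<Rightarrow> nat \<Rightarrow> 's \<Rightarrow> real) \<Rightarrow> bool" where
  "monodisperse_initial S lam \<longleftrightarrow>
     (\<forall>x\<in>S. site_moment lam 1 x 0 = ennreal (lam 0 1 x)) \<and>
     ((\<lambda>x. lam 0 1 x) has_sum 1) S"

text \<open>
  Uniform convergence in \<open>t \<in> [0, T)\<close> of the series over \<open>y \<in> S\<close> of \<open>G x y * m\<^sub>2 x t * m\<^sub>k y t\<close>. The
  terms are nonnegative, so convergence along the finite subsets of \<open>S\<close> agrees with convergence of
  the partial sums of any enumeration of \<open>S\<close>.
\<close>

definition moment_control ::
  "'s set \<Rightarrow> ('s \<Rightarrow> 's \<Rightarrow> real) \<Rightarrow> (real \<Rightarrow> nat \<Rightarrow> 's \<Rightarrow> real) \<Rightarrow> real \<Rightarrow> nat \<Rightarrow> bool" where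
  "moment_control S G lam T k \<longleftrightarrow>
     (\<forall>x\<in>S. \<exists>l. uniform_limit {0..<T}
        (\<lambda>F t. \<Sum>y\<in>F. G x y * enn2real (site_moment lam 2 x t) * enn2real (site_moment lam k y t))
        l (finite_subsets_at_top S))"

definition size_biased :: "'s set \<Rightarrow> (real \<Rightarrow> nat \<Rightarrow> 's \<Rightarrow> real) \<Rightarrow> real \<Rightarrow> 's \<Rightarrow> real" where
  "size_biased S lam t x =
     enn2real (site_moment lam 2 x t) / enn2real (total_moment S lam 2 t)"

definition gel_rate ::
  "'s set \<Rightarrow> ('s \<Rightarrow> 's \<Rightarrow> real) \<Rightarrow> (real \<Rightarrow> nat \<Rightarrow> 's \<Rightarrow> real) \<Rightarrow> real \<Rightarrow> real" where
  "gel_rate S G lam t =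
     (\<Sum>\<^sub>\<infinity>(x, y)\<in>S \<times> S. G x y * size_biased S lam t x * size_biased S lam t y)"

end

theory Submission
  imports Defs
begin

text \<open>
  Testing the equation at site \<open>x\<close> with \<open>i \<mapsto> i * g i\<close> gives the exact identity
  \<open>d/dt \<Sum>i. i * g i * \<lambda>(i,x) = \<Sum>y j k. G x y * j\<^sup>2 * k * \<lambda>(j,x) * \<lambda>(k,y) * (g (j+k) - g j)\<close>.
  Formally \<open>g i = i\<close> yields \<open>d/dt m\<^sub>2(x) = m\<^sub>2(x) * (\<Sum>y. G x y * m\<^sub>2(y))\<close>. To make this rigorous, take for
  \<open>g\<close> tent functions of growing height: their support is finite, and being 1-Lipschitz they keep the
  right-hand side below \<open>m\<^sub>2(x) * (\<Sum>y. G x y * m\<^sub>2(y))\<close>, which is bounded on compact time intervals, so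
  dominated convergence gives the integrated identity up to the gelation time.
  Hence each \<open>m\<^sub>2(x)\<close> is continuous and nondecreasing in time, its values at time \<open>T\<close> serve as
  Weierstrass majorants on \<open>[0,T]\<close>, and the identity can be summed over \<open>x\<close> and differentiated.
  The formula for the gelation time follows from \<open>d/dt (1/M\<^sub>2) = - \<alpha>\<close> and \<open>M\<^sub>2 \<rightarrow> \<infinity>\<close>.
\<close>

section \<open>Infinite sums over arbitrary index sets\<close>

lemma sum_le_infsum_ennreal:
  fixes f :: "'a \<Rightarrow> ennreal"
  assumes "finite F" "F \<subseteq> A"
  shows "sum f F \<le> infsum f A"
  unfolding nonneg_infsum_complete[of A f, simplified] using assms by (intro SUP_upper) auto

text \<open>\<open>enn2real\<close> is continuous only at finite values and additive only on finite
  terms. A finite total supplies both, so a moment finite in \<open>ennreal\<close> becomes a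
  convergent real sum.\<close>

lemma has_sum_enn2real:
  fixes f :: "'a \<Rightarrow> ennreal"
  assumes "infsum f A < \<infinity>"
  shows "((\<lambda>x. enn2real (f x)) has_sum enn2real (infsum f A)) A"
proof -
  have fin: "f x < top" if "x \<in> A" for x
    using sum_le_infsum_ennreal[of "{x}" A f] that assms by (simp add: le_less_trans)
  have "((\<lambda>F. enn2real (sum f F)) \<longlongrightarrow> enn2real (infsum f A)) (finite_subsets_at_top A)"
    using assms has_sum_infsum[of f A] by (intro tendsto_enn2real) (auto simp: has_sum_def nonneg_summable_on_complete)
  then show ?thesis
    unfolding has_sum_def
  proof (rule Lim_transform_eventually)
    show "\<forall>\<^sub>F F in finite_subsets_at_top A. enn2real (sum f F) = (\<Sum>x\<in>F. enn2real (f x))"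
      by (rule eventually_finite_subsets_at_top_weakI) (use fin in \<open>auto simp: subset_eq enn2real_sum\<close>)
  qed
qed

text \<open>By the Weierstrass test the summable majorant makes the partial sums converge uniformly
  in \<open>n\<close>, so the limit over finite subsets and the limit along \<open>F\<close> can be
  exchanged.\<close>

lemma tendsto_infsum_dominated:
  fixes f :: "'a \<Rightarrow> 'b \<Rightarrow> real"
  assumes lim: "\<And>x. x \<in> A \<Longrightarrow> (f x \<longlongrightarrow> g x) F"
    and bound: "\<And>x n. x \<in> A \<Longrightarrow> \<bar>f x n\<bar> \<le> h x"
    and h: "h summable_on A"
    and F: "F \<noteq> bot"
  shows "((\<lambda>n. \<Sum>\<^sub>\<infinity>x\<in>A. f x n) \<longlongrightarrow> (\<Sum>\<^sub>\<infinity>x\<in>A. g x)) F"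
proof -
  have "\<bar>g x\<bar> \<le> h x" if "x \<in> A" for x
    using tendsto_rabs[OF lim[OF that]] bound[OF that] F
    by (intro tendsto_upperbound[of "\<lambda>n. \<bar>f x n\<bar>"]) auto
  then have "g summable_on A"
    using Infinite_Sum.abs_summable_on_comparison_test'[OF h, of g] by (auto intro: abs_summable_summable)
  show ?thesis
  proof (rule swap_uniform_limit')
    show "\<forall>\<^sub>F X in finite_subsets_at_top A. ((\<lambda>n. \<Sum>x\<in>X. f x n) \<longlongrightarrow> (\<Sum>x\<in>X. g x)) F"
      by (rule eventually_finite_subsets_at_top_weakI) (use lim in \<open>auto intro!: tendsto_sum\<close>)
    show "((\<lambda>X. \<Sum>x\<in>X. g x) \<longlongrightarrow> (\<Sum>\<^sub>\<infinity>x\<in>A. g x)) (finite_subsets_at_top A)"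
      using has_sum_infsum[OF \<open>g summable_on A\<close>] by (simp add: has_sum_def)
    show "uniform_limit UNIV (\<lambda>X n. \<Sum>x\<in>X. f x n) (\<lambda>n. \<Sum>\<^sub>\<infinity>x\<in>A. f x n) (finite_subsets_at_top A)"
      by (rule Weierstrass_m_test_general[OF _ h]) (use bound in auto)
  qed auto
qed

lemma has_sum_sum:
  fixes f :: "'a \<Rightarrow> 'b \<Rightarrow> real"
  assumes "\<And>i. i \<in> I \<Longrightarrow> (f i has_sum s i) A"
  shows "((\<lambda>x. \<Sum>i\<in>I. f i x) has_sum (\<Sum>i\<in>I. s i)) A"
  using assms by (induction I rule: infinite_finite_induct) (auto intro!: has_sum_add)

section \<open>Finite convolutions and tent functions\<close>

lemma sum_convolution_finite_support:
  fixes g a c :: "nat \<Rightarrow> real"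
  assumes g: "\<And>i. i > N \<Longrightarrow> g i = 0"
  shows "(\<Sum>i = 1..N. g i * (\<Sum>j = 1..<i. a j * c (i - j)))
       = (\<Sum>j = 1..N. a j * (\<Sum>k = 1..N. c k * g (j + k)))"
proof -
  have "(\<Sum>(i, j)\<in>(SIGMA i:{1..N}. {1..<i}). g i * (a j * c (i - j)))
      = (\<Sum>(j, k)\<in>{1..N} \<times> {1..N}. a j * (c k * g (j + k)))"
    \<comment> \<open>The substitution \<open>k = i - j\<close> maps the triangle onto the pairs
      with \<open>j + k \<le> N\<close>. The rest of the square, \<open>T'\<close>, contributes
      nothing because \<open>g (j + k) = 0\<close> there.\<close>
    by (rule sum.reindex_bij_witness_not_neutral[where
          S' = "{}" and T' = "{(j, k) \<in> {1..N} \<times> {1..N}. j + k > N}"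
          and i = "\<lambda>(j, k). (j + k, j)" and j = "\<lambda>(i, j). (j, i - j)"])
       (auto simp: g intro: finite_subset[of _ "{1..N} \<times> {1..N}"])
  then show ?thesis
    by (simp add: sum_distrib_left sum.Sigma sum.cartesian_product)
qed

text \<open>Subtraction of naturals truncates, so the value beyond \<open>2 * n\<close> is 0, where
  the same formula over the reals would be negative.\<close>

definition tent :: "nat \<Rightarrow> nat \<Rightarrow> real" where
  "tent n i = real (min i (2 * n - i))"

lemma tent_eq_0: "i > 2 * n \<Longrightarrow> tent n i = 0"
  and tent_eq_id: "i \<le> n \<Longrightarrow> tent n i = real i"
  and tent_nonneg: "0 \<le> tent n i"
  and tent_le: "tent n i \<le> real i"
  and tent_Lipschitz: "\<bar>tent n (j + k) - tent n j\<bar> \<le> real k"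
  by (auto simp: tent_def min_def)

lemma tendsto_tent: "(\<lambda>n. tent n i) \<longlonglongrightarrow> real i"
  by (rule tendsto_eventually)
     (use eventually_ge_at_top[of i] in \<open>eventually_elim, auto simp: tent_eq_id\<close>)

section \<open>Moments and interaction sums before gelation\<close>

locale spatial_coagulation =
  fixes S :: "'s set" and G :: "'s \<Rightarrow> 's \<Rightarrow> real" and lam :: "real \<Rightarrow> nat \<Rightarrow> 's \<Rightarrow> real"
    and C :: real
  assumes G_pos: "\<And>x y. x \<in> S \<Longrightarrow> y \<in> S \<Longrightarrow> 0 < G x y"
    and G_le: "\<And>x y. x \<in> S \<Longrightarrow> y \<in> S \<Longrightarrow> G x y \<le> C"
    and solution: "coag_solution S G lam"
begin

definition m2 :: "'s \<Rightarrow> real \<Rightarrow> real" where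
  "m2 x t = enn2real (site_moment lam 2 x t)"

definition M2 :: "real \<Rightarrow> real" where
  "M2 t = enn2real (total_moment S lam 2 t)"

text \<open>A particle of mass \<open>j\<close> at \<open>x\<close> merges with partners of mass
  \<open>k\<close> at rate \<open>j * flux x t k\<close>. All interaction with other sites enters
  the equation through this quantity.\<close>

definition flux :: "'s \<Rightarrow> real \<Rightarrow> nat \<Rightarrow> real" where
  "flux x t k = (\<Sum>\<^sub>\<infinity>y\<in>S. G x y * (real k * lam t k y))"

definition growth :: "'s \<Rightarrow> real \<Rightarrow> real" where
  "growth x t = (\<Sum>\<^sub>\<infinity>y\<in>S. G x y * m2 y t)"

definition before_gel :: "real \<Rightarrow> bool" where
  "before_gel t \<longleftrightarrow> 0 \<le> t \<and> ereal t < gel_time S lam"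

lemma before_gel_mono: "before_gel T \<Longrightarrow> 0 \<le> t \<Longrightarrow> t \<le> T \<Longrightarrow> before_gel t"
  unfolding before_gel_def by (meson ereal_less_eq(3) order_le_less_trans)

lemma lam_nonneg: "before_gel t \<Longrightarrow> i \<ge> 1 \<Longrightarrow> x \<in> S \<Longrightarrow> 0 \<le> lam t i x"
  using solution unfolding coag_solution_def before_gel_def by blast

lemma lam_deriv:
  "before_gel t \<Longrightarrow> i \<ge> 1 \<Longrightarrow> x \<in> S \<Longrightarrow>
     ((\<lambda>s. lam s i x) has_real_derivative coag_rhs S G lam t i x) (at t within {0..})"
  using solution unfolding coag_solution_def before_gel_def by blast

lemma total_moment_bounded:
  assumes "before_gel T"
  obtains B where "B \<ge> 0" "\<And>t. 0 \<le> t \<Longrightarrow> t \<le> T \<Longrightarrow> total_moment S lam 2 t \<le> ennreal B"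
proof -
  obtain B where B: "\<forall>t\<in>{0..T}. total_moment S lam 2 t \<le> ennreal B"
    using solution assms unfolding coag_solution_def before_gel_def by blast
  show ?thesis
    \<comment> \<open>\<open>ennreal\<close> sends negative reals to 0, so replacing a negative
      \<open>B\<close> by 0 leaves the bound unchanged.\<close>
    by (rule that[of "max 0 B"]) (use B in \<open>auto simp: ennreal_max_0\<close>)
qed

lemma total_moment_finite: "before_gel t \<Longrightarrow> total_moment S lam 2 t < \<infinity>"
  by (rule total_moment_bounded[of t])
     (auto simp: before_gel_def intro: le_less_trans[OF _ ennreal_less_top])

lemma m2_nonneg: "0 \<le> m2 x t"
  by (simp add: m2_def)

lemma M2_has_sum: "before_gel t \<Longrightarrow> ((\<lambda>x. m2 x t) has_sum M2 t) S"
  using has_sum_enn2real[of "\<lambda>x. site_moment lam 2 x t" S] total_moment_finite[of t]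
  by (simp add: m2_def M2_def total_moment_def)

lemma m2_le_M2: "before_gel t \<Longrightarrow> x \<in> S \<Longrightarrow> m2 x t \<le> M2 t"
  using finite_sum_le_has_sum[OF M2_has_sum, of t "{x}"] by (simp add: m2_nonneg)

lemma site_moment_finite:
  assumes "before_gel t" "x \<in> S"
  shows "site_moment lam 2 x t < \<infinity>"
proof -
  have "(\<Sum>y\<in>{x}. site_moment lam 2 y t) \<le> total_moment S lam 2 t"
    unfolding total_moment_def using assms by (intro sum_le_infsum_ennreal) auto
  then show ?thesis
    using total_moment_finite[OF assms(1)] by (simp add: le_less_trans)
qed

lemma m2_has_sum:
  assumes "before_gel t" "x \<in> S"
  shows "((\<lambda>i. (real i)\<^sup>2 * lam t i x) has_sum m2 x t) {1..}"
proof -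
  have "((\<lambda>i. enn2real (ennreal ((real i)\<^sup>2 * lam t i x))) has_sum m2 x t) {1..}"
    using has_sum_enn2real[of "\<lambda>i. ennreal ((real i)\<^sup>2 * lam t i x)" "{1..}"]
      site_moment_finite[OF assms]
    by (simp add: m2_def site_moment_def)
  then show ?thesis
    by (rule has_sum_cong[THEN iffD1, rotated]) (use assms lam_nonneg in auto)
qed

lemma growth_has_sum:
  assumes "before_gel t" "x \<in> S"
  shows "((\<lambda>y. G x y * m2 y t) has_sum growth x t) S"
proof -
  have "(\<lambda>y. C * m2 y t) summable_on S"
    by (rule summable_on_cmult_right[OF has_sum_imp_summable[OF M2_has_sum[OF assms(1)]]])
  then have "(\<lambda>y. G x y * m2 y t) summable_on S"
    by (rule summable_on_comparison_test)
       (use assms in \<open>auto intro!: mult_right_mono mult_nonneg_nonneg G_le m2_nonneg less_imp_le[OF G_pos]\<close>)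
  then show ?thesis
    by (simp add: growth_def)
qed

lemma growth_nonneg: "x \<in> S \<Longrightarrow> 0 \<le> growth x t"
  unfolding growth_def using G_pos m2_nonneg
  by (intro infsum_nonneg) (simp add: less_imp_le)

lemma growth_le:
  assumes "before_gel t" "x \<in> S"
  shows "growth x t \<le> C * M2 t"
  by (rule has_sum_mono[OF growth_has_sum[OF assms] has_sum_cmult_right[OF M2_has_sum[OF assms(1)]]])
     (use assms G_le m2_nonneg in \<open>auto intro!: mult_right_mono\<close>)

text \<open>The terms are nonnegative, so iterated summability makes the double series
  unconditionally summable. Every later exchange of a sum over sites with a sum over masses rests on
  this.\<close>

lemma pair_has_sum:
  assumes "before_gel t" "x \<in> S"
  shows "((\<lambda>(y, k). G x y * ((real k)\<^sup>2 * lam t k y)) has_sum growth x t) (S \<times> {1..})"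
proof (rule has_sum_SigmaI)
  show inner: "((\<lambda>k. case (y, k) of (y, k) \<Rightarrow> G x y * ((real k)\<^sup>2 * lam t k y)) has_sum G x y * m2 y t) {1..}"
    if "y \<in> S" for y
    using has_sum_cmult_right[OF m2_has_sum[OF assms(1) that]] by simp
  show "((\<lambda>y. G x y * m2 y t) has_sum growth x t) S"
    by (rule growth_has_sum[OF assms])
  show "(\<lambda>(y, k). G x y * ((real k)\<^sup>2 * lam t k y)) summable_on S \<times> {1..}"
    by (rule summable_on_SigmaI[OF inner])
       (use has_sum_imp_summable[OF growth_has_sum[OF assms]] assms lam_nonneg G_pos
        in \<open>auto simp: less_imp_le\<close>)
qed

text \<open>Masses are at least 1, so \<open>k\<close> is at most its square and the previous double
  series dominates.\<close>

lemma first_pair_summable: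
  assumes "before_gel t" "x \<in> S"
  shows "(\<lambda>(y, k). G x y * (real k * lam t k y)) summable_on (S \<times> {1..})"
proof (rule summable_on_comparison_test)
  show "(\<lambda>(y, k). G x y * ((real k)\<^sup>2 * lam t k y)) summable_on (S \<times> {1..})"
    by (rule has_sum_imp_summable[OF pair_has_sum[OF assms]])
qed (use assms lam_nonneg G_pos in
     \<open>auto simp: less_imp_le power2_eq_square intro!: mult_left_mono mult_right_mono\<close>)

lemma flux_has_sum_site:
  assumes "before_gel t" "x \<in> S" "k \<ge> 1"
  shows "((\<lambda>y. G x y * (real k * lam t k y)) has_sum flux x t k) S"
proof -
  have "(\<lambda>(k, y). G x y * (real k * lam t k y)) summable_on ({1..} \<times> S)"
    using first_pair_summable[OF assms(1,2)] by (subst summable_on_swap) simp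
  from summable_on_SigmaD1[OF this, of k] show ?thesis
    using assms(3) by (simp add: flux_def)
qed

lemma flux_nonneg:
  assumes "before_gel t" "x \<in> S" "k \<ge> 1"
  shows "0 \<le> flux x t k"
  unfolding flux_def using assms G_pos lam_nonneg
  by (intro infsum_nonneg) (simp add: less_imp_le)

text \<open>Fubini for the double series. It makes \<open>k * flux x t k\<close> a summable majorant
  for the tent increments.\<close>

lemma growth_has_sum_flux:
  assumes "before_gel t" "x \<in> S"
  shows "((\<lambda>k. real k * flux x t k) has_sum growth x t) {1..}"
proof (rule has_sum_SigmaD)
  show "((\<lambda>(k, y). G x y * ((real k)\<^sup>2 * lam t k y)) has_sum growth x t) ({1..} \<times> S)"
    using pair_has_sum[OF assms] by (subst has_sum_swap) simp
  show "((\<lambda>y. case (k, y) of (k, y) \<Rightarrow> G x y * ((real k)\<^sup>2 * lam t k y)) has_sum real k * flux x t k) S"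
    if "k \<in> {1..}" for k
    using has_sum_cmult_right[OF flux_has_sum_site[OF assms, of k], of "real k"] that
    by (simp add: power2_eq_square mult_ac)
qed

lemma flux_summable:
  assumes "before_gel t" "x \<in> S"
  shows "flux x t summable_on {1..}"
proof (rule summable_on_comparison_test)
  show "(\<lambda>k. real k * flux x t k) summable_on {1..}"
    by (rule has_sum_imp_summable[OF growth_has_sum_flux[OF assms]])
  show "flux x t k \<le> real k * flux x t k" if "k \<in> {1..}" for k
    using mult_right_mono[of 1 "real k" "flux x t k"] flux_nonneg[OF assms, of k] that by simp
qed (use flux_nonneg[OF assms] in auto)

section \<open>The equation tested against tents\<close>

lemma coag_rhs_eq:
  assumes "before_gel t" "x \<in> S" "i \<ge> 1"
  shows "real i * coag_rhs S G lam t i x =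
    (\<Sum>j = 1..<i. ((real j)\<^sup>2 * lam t j x) * flux x t (i - j))
    - (real i)\<^sup>2 * lam t i x * infsum (flux x t) {1..}"
proof -
  \<comment> \<open>The sum over sites goes inside the finite sum over \<open>j\<close> and produces
    the flux. The remaining \<open>1 / i\<close> cancels against the test factor \<open>i\<close>,
    which leaves a convolution.\<close>
  have "((\<lambda>y. \<Sum>j = 1..<i. (real j)\<^sup>2 * lam t j x / real i * (G x y * (real (i - j) * lam t (i - j) y)))
      has_sum (\<Sum>j = 1..<i. (real j)\<^sup>2 * lam t j x / real i * flux x t (i - j))) S"
    by (intro has_sum_sum has_sum_cmult_right flux_has_sum_site assms) auto
  then have "(\<Sum>\<^sub>\<infinity>y\<in>S. \<Sum>j = 1..<i.
        (real j / real i) * (real j * real (i - j)) * G x y * lam t j x * lam t (i - j) y)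
      = (\<Sum>j = 1..<i. (real j)\<^sup>2 * lam t j x / real i * flux x t (i - j))"
    by (intro infsumI) (simp add: power2_eq_square mult_ac)
  moreover have "(\<Sum>\<^sub>\<infinity>y\<in>S. \<Sum>\<^sub>\<infinity>k\<in>{1..}. real k * G x y * lam t k y) = infsum (flux x t) {1..}"
    unfolding flux_def
    by (subst infsum_swap_banach[symmetric, OF first_pair_summable[OF assms(1,2)]])
       (simp add: mult_ac)
  ultimately show ?thesis
    using assms(3) unfolding coag_rhs_def
    by (simp only: right_diff_distrib sum_distrib_left) (simp add: power2_eq_square mult.assoc)
qed

text \<open>Gain and loss are merged: absorbing mass \<open>k\<close> changes the weight of a
  particle of mass \<open>j\<close> from \<open>tent n j\<close> to
  \<open>tent n (j + k)\<close>.\<close>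

definition truncated_rate :: "nat \<Rightarrow> 's \<Rightarrow> real \<Rightarrow> real" where
  "truncated_rate n x t = (\<Sum>\<^sub>\<infinity>j\<in>{1..}. (real j)\<^sup>2 * lam t j x *
     (\<Sum>\<^sub>\<infinity>k\<in>{1..}. flux x t k * (tent n (j + k) - tent n j)))"

lemma tent_flux_le:
  assumes "before_gel t" "x \<in> S" "k \<ge> 1"
  shows "\<bar>flux x t k * (tent n (j + k) - tent n j)\<bar> \<le> real k * flux x t k"
proof -
  have "flux x t k * \<bar>tent n (j + k) - tent n j\<bar> \<le> flux x t k * real k"
    by (intro mult_left_mono tent_Lipschitz flux_nonneg assms)
  then show ?thesis
    by (simp only: abs_mult abs_of_nonneg[OF flux_nonneg[OF assms]] mult.commute)
qed

text \<open>The Lipschitz majorant \<open>k * flux x t k\<close> depends on neither \<open>n\<close>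
  nor \<open>j\<close>, and its sum is \<open>growth x t\<close>.\<close>

lemma tent_flux_summable:
  assumes "before_gel t" "x \<in> S"
  shows "(\<lambda>k. flux x t k * (tent n (j + k) - tent n j)) summable_on {1..}"
    and "\<bar>\<Sum>\<^sub>\<infinity>k\<in>{1..}. flux x t k * (tent n (j + k) - tent n j)\<bar> \<le> growth x t"
proof -
  have le: "\<bar>flux x t k * (tent n (j + k) - tent n j)\<bar> \<le> real k * flux x t k" if "k \<in> {1..}" for k
    by (rule tent_flux_le[OF assms]) (use that in simp)
  show sm: "(\<lambda>k. flux x t k * (tent n (j + k) - tent n j)) summable_on {1..}"
    using le unfolding real_norm_def[symmetric]
    by (rule abs_summable_summable[OF Infinite_Sum.abs_summable_on_comparison_test'
          [OF has_sum_imp_summable[OF growth_has_sum_flux[OF assms]]]])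
  show "\<bar>\<Sum>\<^sub>\<infinity>k\<in>{1..}. flux x t k * (tent n (j + k) - tent n j)\<bar> \<le> growth x t"
    using norm_infsum_le[OF has_sum_infsum[OF sm] growth_has_sum_flux[OF assms]] le
    unfolding real_norm_def .
qed

lemma truncated_rate_eq:
  assumes "before_gel t" "x \<in> S"
  shows "(\<Sum>i = 1..2 * n. real i * tent n i * coag_rhs S G lam t i x) = truncated_rate n x t"
proof -
  let ?a = "\<lambda>j. (real j)\<^sup>2 * lam t j x" and ?c = "flux x t" and ?g = "tent n"
  have "(\<Sum>i = 1..2 * n. real i * ?g i * coag_rhs S G lam t i x)
      = (\<Sum>i = 1..2 * n. ?g i * (\<Sum>j = 1..<i. ?a j * ?c (i - j)))
        - (\<Sum>i = 1..2 * n. ?a i * (?g i * infsum ?c {1..}))"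
    unfolding sum_subtractf[symmetric]
  proof (intro sum.cong refl)
    fix i assume "i \<in> {1..2 * n}"
    then have "?g i * (real i * coag_rhs S G lam t i x)
        = ?g i * ((\<Sum>j = 1..<i. ?a j * ?c (i - j)) - ?a i * infsum ?c {1..})"
      using coag_rhs_eq[OF assms, of i] by simp
    then show "real i * ?g i * coag_rhs S G lam t i x
        = ?g i * (\<Sum>j = 1..<i. ?a j * ?c (i - j)) - ?a i * (?g i * infsum ?c {1..})"
      by (simp add: right_diff_distrib mult_ac)
  qed
  also have "\<dots> = (\<Sum>j = 1..2 * n. ?a j *
      ((\<Sum>k = 1..2 * n. ?c k * ?g (j + k)) - infsum ?c {1..} * ?g j))"
    by (subst sum_convolution_finite_support)
       (simp_all add: tent_eq_0 sum_subtractf right_diff_distrib mult_ac)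
  \<comment> \<open>For \<open>k > 2 * n\<close> the gain vanishes because
    \<open>tent n (j + k) = 0\<close>. The finite gain sum is therefore also an infinite one and can
    be joined with the loss, which carries the total flux.\<close>
  also have "\<dots> = (\<Sum>j = 1..2 * n. ?a j * (\<Sum>\<^sub>\<infinity>k\<in>{1..}. ?c k * (?g (j + k) - ?g j)))"
  proof (intro sum.cong refl arg_cong2[where f = "(*)"])
    fix j
    have "((\<lambda>k. ?c k * ?g (j + k)) has_sum (\<Sum>k = 1..2 * n. ?c k * ?g (j + k))) {1..}"
      by (rule has_sum_cong_neutral[THEN iffD1, OF _ _ _ has_sum_finite]) (auto simp: tent_eq_0)
    from has_sum_add[OF this has_sum_cmult_left[OF has_sum_infsum[OF flux_summable[OF assms]], of "- ?g j"]]
    show "(\<Sum>k = 1..2 * n. ?c k * ?g (j + k)) - infsum ?c {1..} * ?g j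
        = (\<Sum>\<^sub>\<infinity>k\<in>{1..}. ?c k * (?g (j + k) - ?g j))"
      by (intro infsumI[symmetric]) (simp add: right_diff_distrib)
  qed
  \<comment> \<open>For \<open>j > 2 * n\<close> both tent values are 0, so the outer sum extends to
    all masses.\<close>
  also have "\<dots> = truncated_rate n x t"
    unfolding truncated_rate_def
    by (subst infsum_finite[symmetric], simp, rule infsum_cong_neutral) (auto simp: tent_eq_0)
  finally show ?thesis .
qed

lemma m2_summable:
  assumes "before_gel t" "x \<in> S"
  shows "(\<lambda>i. (real i)\<^sup>2 * lam t i x) summable_on {1..}"
  by (rule has_sum_imp_summable[OF m2_has_sum[OF assms]])

lemma truncated_rate_bound:
  assumes "before_gel t" "x \<in> S"
  shows "\<bar>truncated_rate n x t\<bar> \<le> m2 x t * growth x t"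
proof -
  have le: "\<bar>(real j)\<^sup>2 * lam t j x * (\<Sum>\<^sub>\<infinity>k\<in>{1..}. flux x t k * (tent n (j + k) - tent n j))\<bar>
      \<le> (real j)\<^sup>2 * lam t j x * growth x t" if "j \<in> {1..}" for j
    using tent_flux_summable(2)[OF assms] lam_nonneg[OF assms(1) _ assms(2), of j] that
    by (simp add: abs_mult mult_left_mono)
  note hs = has_sum_cmult_left[OF m2_has_sum[OF assms], of "growth x t"]
  have sm: "(\<lambda>j. (real j)\<^sup>2 * lam t j x *
      (\<Sum>\<^sub>\<infinity>k\<in>{1..}. flux x t k * (tent n (j + k) - tent n j))) summable_on {1..}"
    using le unfolding real_norm_def[symmetric]
    by (rule abs_summable_summable[OF
        Infinite_Sum.abs_summable_on_comparison_test'[OF has_sum_imp_summable[OF hs]]])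
  show ?thesis
    unfolding truncated_rate_def
    using norm_infsum_le[OF has_sum_infsum[OF sm] hs] le unfolding real_norm_def .
qed

text \<open>Dominated convergence is used twice: in \<open>k\<close>, where the increments tend to
  \<open>(j + k) - j = k\<close>, and in \<open>j\<close>, where the inner sums tend to
  \<open>growth x t\<close> and are bounded by it.\<close>

lemma truncated_rate_tendsto:
  assumes "before_gel t" "x \<in> S"
  shows "(\<lambda>n. truncated_rate n x t) \<longlonglongrightarrow> m2 x t * growth x t"
proof -
  have inner: "(\<lambda>n. \<Sum>\<^sub>\<infinity>k\<in>{1..}. flux x t k * (tent n (j + k) - tent n j)) \<longlonglongrightarrow> growth x t" for j
  proof -
    have "(\<lambda>n. \<Sum>\<^sub>\<infinity>k\<in>{1..}. flux x t k * (tent n (j + k) - tent n j))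
        \<longlonglongrightarrow> (\<Sum>\<^sub>\<infinity>k\<in>{1..}. flux x t k * (real (j + k) - real j))"
    proof (rule tendsto_infsum_dominated)
      show "(\<lambda>k. real k * flux x t k) summable_on {1..}"
        by (rule has_sum_imp_summable[OF growth_has_sum_flux[OF assms]])
      show "\<bar>flux x t k * (tent n (j + k) - tent n j)\<bar> \<le> real k * flux x t k" if "k \<in> {1..}" for k n
        by (rule tent_flux_le[OF assms]) (use that in simp)
    qed (intro tendsto_intros tendsto_tent, simp)
    also have "(\<Sum>\<^sub>\<infinity>k\<in>{1..}. flux x t k * (real (j + k) - real j)) = growth x t"
      using growth_has_sum_flux[OF assms] by (intro infsumI) (simp add: mult.commute)
    finally show ?thesis .
  qed
  have "(\<lambda>n. truncated_rate n x t) \<longlonglongrightarrow> (\<Sum>\<^sub>\<infinity>j\<in>{1..}. (real j)\<^sup>2 * lam t j x * growth x t)"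
    unfolding truncated_rate_def
  proof (rule tendsto_infsum_dominated)
    show "(\<lambda>j. (real j)\<^sup>2 * lam t j x * growth x t) summable_on {1..}"
      by (intro summable_on_cmult_left m2_summable assms)
    show "\<bar>(real j)\<^sup>2 * lam t j x * (\<Sum>\<^sub>\<infinity>k\<in>{1..}. flux x t k * (tent n (j + k) - tent n j))\<bar>
        \<le> (real j)\<^sup>2 * lam t j x * growth x t" if "j \<in> {1..}" for j n
      using tent_flux_summable(2)[OF assms] lam_nonneg[OF assms(1) _ assms(2), of j] that
      by (simp add: abs_mult mult_left_mono)
  qed (intro tendsto_intros inner, simp)
  also have "(\<Sum>\<^sub>\<infinity>j\<in>{1..}. (real j)\<^sup>2 * lam t j x * growth x t) = m2 x t * growth x t"
    by (intro infsumI has_sum_cmult_left m2_has_sum assms)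
  finally show ?thesis .
qed

section \<open>The integrated identity for the second moment at a site\<close>

definition truncated_moment :: "nat \<Rightarrow> 's \<Rightarrow> real \<Rightarrow> real" where
  "truncated_moment n x t = (\<Sum>i = 1..2 * n. real i * tent n i * lam t i x)"

lemma truncated_moment_tendsto:
  assumes "before_gel t" "x \<in> S"
  shows "(\<lambda>n. truncated_moment n x t) \<longlonglongrightarrow> m2 x t"
proof -
  have eq: "truncated_moment n x t = (\<Sum>\<^sub>\<infinity>i\<in>{1..}. real i * tent n i * lam t i x)" for n
    unfolding truncated_moment_def
    by (subst infsum_finite[symmetric], simp, rule infsum_cong_neutral) (auto simp: tent_eq_0)
  have "(\<lambda>n. truncated_moment n x t) \<longlonglongrightarrow> (\<Sum>\<^sub>\<infinity>i\<in>{1..}. real i * real i * lam t i x)"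
    unfolding eq
  proof (rule tendsto_infsum_dominated[OF _ _ m2_summable[OF assms]])
    show "\<bar>real i * tent n i * lam t i x\<bar> \<le> (real i)\<^sup>2 * lam t i x" if "i \<in> {1..}" for i n
      using tent_nonneg[of n i] tent_le[of n i] lam_nonneg[OF assms(1) _ assms(2), of i] that
      by (auto simp: abs_mult power2_eq_square intro!: mult_right_mono mult_left_mono)
  qed (auto intro!: tendsto_intros tendsto_tent)
  also have "(\<Sum>\<^sub>\<infinity>i\<in>{1..}. real i * real i * lam t i x) = m2 x t"
    using m2_has_sum[OF assms] by (intro infsumI) (simp add: power2_eq_square)
  finally show ?thesis .
qed

lemma truncated_moment_deriv:
  assumes "before_gel t" "x \<in> S"
  shows "((\<lambda>s. truncated_moment n x s) has_real_derivative truncated_rate n x t) (at t within {0..})"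
  unfolding truncated_moment_def truncated_rate_eq[OF assms, symmetric]
  by (intro DERIV_sum DERIV_cmult lam_deriv assms) auto

lemma m2_has_integral:
  assumes "before_gel t" "x \<in> S"
  shows "((\<lambda>s. m2 x s * growth x s) has_integral m2 x t - m2 x 0) {0..t}"
proof -
  have t: "0 \<le> t"
    using assms by (simp add: before_gel_def)
  have pre: "before_gel s" if "s \<in> {0..t}" for s
    using before_gel_mono[OF assms(1)] that by simp
  obtain B where B: "B \<ge> 0" "\<And>s. 0 \<le> s \<Longrightarrow> s \<le> t \<Longrightarrow> total_moment S lam 2 s \<le> ennreal B"
    using total_moment_bounded[OF assms(1)] by blast
  have M2_le: "M2 s \<le> B" if "s \<in> {0..t}" for s
    unfolding M2_def using B that by (intro enn2real_leI) auto
  \<comment> \<open>A negative \<open>C\<close> is possible only for empty \<open>S\<close>; here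
    \<open>0 < G x x \<le> C\<close>.\<close>
  have C: "0 \<le> C"
    using G_pos[OF assms(2,2)] G_le[OF assms(2,2)] by simp
  \<comment> \<open>The gauge integral integrates every derivative, so this step asks for no
    continuity of \<open>truncated_rate\<close> in time.\<close>
  have int: "(truncated_rate n x has_integral truncated_moment n x t - truncated_moment n x 0) {0..t}"
    for n
    using t
  proof (rule fundamental_theorem_of_calculus)
    fix s assume "s \<in> {0..t}"
    from DERIV_subset[OF truncated_moment_deriv[OF pre[OF this] assms(2)], of "{0..t}"]
    show "(truncated_moment n x has_vector_derivative truncated_rate n x s) (at s within {0..t})"
      by (auto simp: has_real_derivative_iff_has_vector_derivative)
  qed
  \<comment> \<open>The first \<open>B\<close> bounds \<open>m2 x s\<close> through
    \<open>M2 s\<close>, and \<open>C * B\<close> bounds \<open>growth x s\<close>. The product is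
    independent of \<open>n\<close>, as dominated convergence requires.\<close>
  have bound: "norm (truncated_rate n x s) \<le> B * (C * B)" if "s \<in> {0..t}" for n s
  proof -
    note s = pre[OF that] assms(2)
    have "\<bar>truncated_rate n x s\<bar> \<le> m2 x s * growth x s"
      by (rule truncated_rate_bound[OF s])
    also have "\<dots> \<le> B * (C * B)"
    proof (rule mult_mono)
      show "m2 x s \<le> B"
        using m2_le_M2[OF s] M2_le[OF that] by simp
      show "growth x s \<le> C * B"
        using growth_le[OF s] mult_left_mono[OF M2_le[OF that] C] by simp
    qed (use B growth_nonneg[OF assms(2)] in auto)
    finally show ?thesis by simp
  qed
  have "(\<lambda>s. B * (C * B)) integrable_on {0..t}"
    by (rule integrable_const_ivl)
  note dc = dominated_convergence[OF has_integral_integrable[OF int] this bound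
      truncated_rate_tendsto[OF pre assms(2)]]
  have "(\<lambda>n. truncated_moment n x t - truncated_moment n x 0)
      \<longlonglongrightarrow> integral {0..t} (\<lambda>s. m2 x s * growth x s)"
    using dc(2) by (simp add: integral_unique[OF int])
  moreover have "(\<lambda>n. truncated_moment n x t - truncated_moment n x 0) \<longlonglongrightarrow> m2 x t - m2 x 0"
    using t by (intro tendsto_diff truncated_moment_tendsto pre assms) auto
  ultimately have "integral {0..t} (\<lambda>s. m2 x s * growth x s) = m2 x t - m2 x 0"
    by (rule LIMSEQ_unique)
  then show ?thesis
    using dc(1) by (simp add: has_integral_iff)
qed

section \<open>Monotonicity and continuity in time\<close>

lemma m2_mono:
  assumes "before_gel t" "x \<in> S" "0 \<le> s" "s \<le> t"
  shows "m2 x s \<le> m2 x t"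
proof -
  \<comment> \<open>The integrand is nonnegative, so enlarging the interval from
    \<open>{0..s}\<close> to \<open>{0..t}\<close> cannot decrease the integral.\<close>
  have "m2 x s - m2 x 0 \<le> m2 x t - m2 x 0"
    by (rule has_integral_subset_le[OF _ m2_has_integral[OF before_gel_mono] m2_has_integral])
       (use assms in \<open>auto intro!: mult_nonneg_nonneg m2_nonneg growth_nonneg\<close>)
  then show ?thesis by simp
qed

lemma m2_continuous:
  assumes "before_gel T" "x \<in> S"
  shows "continuous_on {0..T} (m2 x)"
proof -
  have "continuous_on {0..T} (\<lambda>t. m2 x 0 + integral {0..t} (\<lambda>s. m2 x s * growth x s))"
    by (intro continuous_intros indefinite_integral_continuous_1
        has_integral_integrable[OF m2_has_integral] assms)
  then show ?thesis
    by (rule continuous_on_eq)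
       (use integral_unique[OF m2_has_integral[OF before_gel_mono[OF assms(1)] assms(2)]] in auto)
qed

lemma growth_continuous:
  assumes "before_gel T" "x \<in> S"
  shows "continuous_on {0..T} (growth x)"
proof (rule uniform_limit_theorem)
  show "\<forall>\<^sub>F F in finite_subsets_at_top S. continuous_on {0..T} (\<lambda>t. \<Sum>y\<in>F. G x y * m2 y t)"
    by (rule eventually_finite_subsets_at_top_weakI)
       (use m2_continuous[OF assms(1)] in \<open>auto intro!: continuous_intros\<close>)
  show "uniform_limit {0..T} (\<lambda>F t. \<Sum>y\<in>F. G x y * m2 y t) (growth x) (finite_subsets_at_top S)"
    unfolding growth_def
  proof (rule Weierstrass_m_test_general)
    show "(\<lambda>y. G x y * m2 y T) summable_on S"
      by (rule has_sum_imp_summable[OF growth_has_sum[OF assms]])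
    show "norm (G x y * m2 y t) \<le> G x y * m2 y T" if "y \<in> S" "t \<in> {0..T}" for y t
      using m2_mono[OF assms(1) that(1), of t] G_pos[OF assms(2) that(1)] that(2) m2_nonneg[of y t]
      by (simp add: mult_left_mono)
  qed
qed simp

section \<open>The differential equation for the total second moment\<close>

definition M2_rate :: "real \<Rightarrow> real" where
  "M2_rate t = (\<Sum>\<^sub>\<infinity>x\<in>S. m2 x t * growth x t)"

lemma M2_rate_term_le:
  assumes "before_gel T" "x \<in> S" "t \<in> {0..T}"
  shows "norm (m2 x t * growth x t) \<le> m2 x T * growth x T"
proof -
  have t: "before_gel t"
    using before_gel_mono[OF assms(1)] assms(3) by simp
  have "growth x t \<le> growth x T"
    by (rule has_sum_mono[OF growth_has_sum[OF t assms(2)] growth_has_sum[OF assms(1,2)]])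
       (use assms m2_mono[OF assms(1)] less_imp_le[OF G_pos] in \<open>auto intro!: mult_left_mono\<close>)
  then show ?thesis
    using m2_mono[OF assms(1,2), of t] assms growth_nonneg[OF assms(2), of t] m2_nonneg[of x]
    by (auto simp: abs_mult intro!: mult_mono)
qed

lemma M2_rate_has_sum:
  assumes "before_gel t"
  shows "((\<lambda>x. m2 x t * growth x t) has_sum M2_rate t) S"
proof -
  have "(\<lambda>x. m2 x t * (C * M2 t)) summable_on S"
    by (rule summable_on_cmult_left[OF has_sum_imp_summable[OF M2_has_sum[OF assms]]])
  then have "(\<lambda>x. m2 x t * growth x t) summable_on S"
    by (rule summable_on_comparison_test)
       (use assms in \<open>auto intro!: mult_left_mono mult_nonneg_nonneg growth_le m2_nonneg growth_nonneg\<close>)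
  then show ?thesis
    by (simp add: M2_rate_def)
qed

text \<open>The conditional makes every partial sum continuous, even for \<open>F\<close> not
  contained in \<open>S\<close>; integrating the uniform limit asks for continuity of all members of
  the family.\<close>

lemma M2_rate_uniform_limit:
  assumes "before_gel T"
  shows "uniform_limit {0..T} (\<lambda>F t. \<Sum>x\<in>F. if x \<in> S then m2 x t * growth x t else 0)
           M2_rate (finite_subsets_at_top S)"
proof (rule Weierstrass_m_test_general')
  show "(\<lambda>x. m2 x T * growth x T) summable_on S"
    by (rule has_sum_imp_summable[OF M2_rate_has_sum[OF assms]])
  show "((\<lambda>x. if x \<in> S then m2 x t * growth x t else 0) has_sum M2_rate t) S" if "t \<in> {0..T}" for t
    by (rule has_sum_cong[THEN iffD1, OF _ M2_rate_has_sum[OF before_gel_mono[OF assms]]])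
       (use that in auto)
qed (use M2_rate_term_le[OF assms] in auto)

lemma M2_rate_partial_continuous:
  assumes "before_gel T"
  shows "continuous_on {0..T} (\<lambda>t. \<Sum>x\<in>F. if x \<in> S then m2 x t * growth x t else 0)"
proof (rule continuous_on_sum)
  fix x
  show "continuous_on {0..T} (\<lambda>t. if x \<in> S then m2 x t * growth x t else 0)"
    using m2_continuous[OF assms] growth_continuous[OF assms]
    by (cases "x \<in> S") (auto intro!: continuous_intros)
qed

lemma M2_rate_continuous:
  assumes "before_gel T"
  shows "continuous_on {0..T} M2_rate"
  by (rule uniform_limit_theorem[OF _ M2_rate_uniform_limit[OF assms]])
     (auto intro!: always_eventually M2_rate_partial_continuous[OF assms])

lemma M2_has_integral:
  assumes "before_gel t"
  shows "(M2_rate has_integral M2 t - M2 0) {0..t}"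
proof -
  have "before_gel 0"
    using before_gel_mono[OF assms] assms by (simp add: before_gel_def)
  obtain I J where I: "\<And>F. ((\<lambda>s. \<Sum>x\<in>F. if x \<in> S then m2 x s * growth x s else 0) has_integral I F) {0..t}"
    and J: "(M2_rate has_integral J) {0..t}" and lim: "(I \<longlongrightarrow> J) (finite_subsets_at_top S)"
    by (rule uniform_limit_integral[OF M2_rate_uniform_limit[OF assms] M2_rate_partial_continuous[OF assms]])
       auto
  \<comment> \<open>The values \<open>I F\<close> come without a formula. Those with
    \<open>F\<close> inside \<open>S\<close> are computed from the site identities, and such
    \<open>F\<close> are eventually all that matter for the limit.\<close>
  have eq: "I F = (\<Sum>x\<in>F. m2 x t + - m2 x 0)" if "finite F" "F \<subseteq> S" for F
  proof (rule has_integral_unique[OF I])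
    have "((\<lambda>s. \<Sum>x\<in>F. m2 x s * growth x s) has_integral (\<Sum>x\<in>F. m2 x t - m2 x 0)) {0..t}"
      by (rule has_integral_sum) (use that m2_has_integral[OF assms] in auto)
    moreover have "(\<lambda>s. \<Sum>x\<in>F. m2 x s * growth x s)
        = (\<lambda>s. \<Sum>x\<in>F. if x \<in> S then m2 x s * growth x s else 0)"
      using that by (intro ext sum.cong) auto
    ultimately show "((\<lambda>s. \<Sum>x\<in>F. if x \<in> S then m2 x s * growth x s else 0)
        has_integral (\<Sum>x\<in>F. m2 x t + - m2 x 0)) {0..t}"
      by simp
  qed
  have "((\<lambda>x. m2 x t + - m2 x 0) has_sum M2 t + - M2 0) S"
    using M2_has_sum[OF assms] M2_has_sum[OF \<open>before_gel 0\<close>]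
    by (intro has_sum_add) (auto simp: has_sum_uminus)
  then have "(I \<longlongrightarrow> M2 t + - M2 0) (finite_subsets_at_top S)"
    unfolding has_sum_def
    by (rule Lim_transform_eventually)
       (rule eventually_finite_subsets_at_top_weakI, simp add: eq)
  then have "J = M2 t - M2 0"
    using tendsto_unique[OF _ lim] by fastforce
  then show ?thesis
    using J by simp
qed

lemma M2_deriv:
  assumes "before_gel t"
  shows "(M2 has_real_derivative M2_rate t) (at t within {0..})"
proof -
  \<comment> \<open>Room to the right of \<open>t\<close> makes \<open>{0..T}\<close> and
    \<open>{0..}\<close> agree near \<open>t\<close>, so the derivative within the first is the
    derivative within the second, one-sided at \<open>t = 0\<close>.\<close>
  obtain T where T: "t < T" "before_gel T"
    using assms ereal_dense2[of "ereal t" "gel_time S lam"] unfolding before_gel_def by auto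
  have t: "t \<in> {0..T}"
    using assms T by (simp add: before_gel_def)
  have "((\<lambda>s. M2 0 + integral {0..s} M2_rate) has_real_derivative 0 + M2_rate t) (at t within {0..T})"
    by (intro DERIV_add DERIV_const integral_has_real_derivative M2_rate_continuous T t)
  then have "(M2 has_real_derivative M2_rate t) (at t within {0..T})"
    using t integral_unique[OF M2_has_integral[OF before_gel_mono[OF T(2)]]]
    by (auto intro: has_field_derivative_transform_within[OF _ zero_less_one])
  also have "at t within {0..T} = at t within {0..}"
    by (rule at_within_nhd[of _ "{..<T}"]) (use T in auto)
  finally show ?thesis .
qed

lemma M2_mono:
  assumes "before_gel t"
  shows "M2 0 \<le> M2 t"
proof -
  have "before_gel 0"
    using before_gel_mono[OF assms] assms by (simp add: before_gel_def)
  then show ?thesis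
    using assms m2_mono[OF assms] by (intro has_sum_mono[OF M2_has_sum M2_has_sum]) (auto simp: before_gel_def)
qed

text \<open>The factor \<open>1 / (M2 t)^2\<close> comes out of the double sum, and summing over
  \<open>y\<close> first gives \<open>m2 x t * growth x t\<close>. If \<open>M2 t = 0\<close>,
  division by zero makes both sides 0.\<close>

lemma gel_rate_eq:
  assumes "before_gel t"
  shows "gel_rate S G lam t = M2_rate t / (M2 t)\<^sup>2"
proof -
  have "((\<lambda>(x, y). G x y * (m2 x t / M2 t) * (m2 y t / M2 t)) has_sum M2_rate t / (M2 t)\<^sup>2) (S \<times> S)"
  proof (rule has_sum_SigmaI)
    show inner: "((\<lambda>y. case (x, y) of (x, y) \<Rightarrow> G x y * (m2 x t / M2 t) * (m2 y t / M2 t))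
        has_sum m2 x t * growth x t / (M2 t)\<^sup>2) S" if "x \<in> S" for x
      using has_sum_cmult_right[OF growth_has_sum[OF assms that], of "m2 x t / (M2 t)\<^sup>2"]
      by (simp add: power2_eq_square mult_ac)
    show outer: "((\<lambda>x. m2 x t * growth x t / (M2 t)\<^sup>2) has_sum M2_rate t / (M2 t)\<^sup>2) S"
      using has_sum_cmult_left[OF M2_rate_has_sum[OF assms], of "1 / (M2 t)\<^sup>2"] by simp
    show "(\<lambda>(x, y). G x y * (m2 x t / M2 t) * (m2 y t / M2 t)) summable_on S \<times> S"
      by (rule summable_on_SigmaI[OF inner has_sum_imp_summable[OF outer]])
         (use G_pos m2_nonneg in \<open>auto simp: M2_def less_imp_le\<close>)
  qed
  then show ?thesis
    unfolding gel_rate_def size_biased_def m2_def M2_def by (rule infsumI)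
qed

section \<open>The initial value\<close>

lemma before_gel_0: "before_gel 0"
  using solution by (simp add: coag_solution_def before_gel_def zero_ereal_def[symmetric])

lemma M2_initial:
  assumes "monodisperse_initial S lam"
  shows "M2 0 = 1"
proof -
  have "m2 x 0 = lam 0 1 x" if x: "x \<in> S" for x
  proof -
    have nonneg: "0 \<le> lam 0 i x" if "i \<ge> 1" for i
      using lam_nonneg[OF before_gel_0 that x] .
    have eq: "(\<Sum>\<^sub>\<infinity>i\<in>{1..}. ennreal (real i * lam 0 i x)) = ennreal (lam 0 1 x)"
      using assms x by (simp add: monodisperse_initial_def site_moment_def)
    have "((\<lambda>i. enn2real (ennreal (real i * lam 0 i x))) has_sum lam 0 1 x) {1..}"
      using has_sum_enn2real[of "\<lambda>i. ennreal (real i * lam 0 i x)" "{1..}"] nonneg[of 1]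
      unfolding eq by simp
    then have sum1: "((\<lambda>i. real i * lam 0 i x) has_sum lam 0 1 x) {1..}"
      by (rule has_sum_cong[THEN iffD1, rotated]) (use nonneg in auto)
    \<comment> \<open>The first moment equals its own term at mass 1, so a partial sum containing a
      second index \<open>i\<close> forces that term to be 0.\<close>
    have zero: "lam 0 i x = 0" if "i \<ge> 2" for i
    proof -
      have "(\<Sum>i\<in>{1, i}. real i * lam 0 i x) \<le> lam 0 1 x"
        by (rule finite_sum_le_has_sum[OF sum1]) (use nonneg that in auto)
      then show ?thesis
        using that nonneg[of i] by (simp add: mult_le_0_iff)
    qed
    \<comment> \<open>Only mass 1 is left, where all powers of the mass agree.\<close>
    have "((\<lambda>i. (real i)\<^sup>2 * lam 0 i x) has_sum (\<Sum>i\<in>{1}. (real i)\<^sup>2 * lam 0 i x)) {1..}"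
      by (rule has_sum_cong_neutral[THEN iffD1, OF _ _ _ has_sum_finite[of "{1}"]]) (auto simp: zero)
    then show ?thesis
      using has_sum_unique[OF m2_has_sum[OF before_gel_0 x]] by fastforce
  qed
  then have "((\<lambda>x. m2 x 0) has_sum 1) S"
    using assms has_sum_cong[of S "\<lambda>x. m2 x 0" "\<lambda>x. lam 0 1 x" 1]
    by (simp add: monodisperse_initial_def)
  then show ?thesis
    using has_sum_unique[OF M2_has_sum[OF before_gel_0]] by blast
qed

section \<open>The gelation time from the inverse second moment\<close>

context
  assumes M2_0_pos: "0 < M2 0"
begin

lemma M2_pos: "before_gel t \<Longrightarrow> 0 < M2 t"
  using M2_mono M2_0_pos by (rule less_le_trans[rotated])

lemma inverse_M2_deriv:
  assumes "before_gel t"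
  shows "((\<lambda>s. - inverse (M2 s)) has_real_derivative gel_rate S G lam t) (at t within {0..})"
  using DERIV_minus[OF DERIV_inverse_fun[OF M2_deriv[OF assms]]] M2_pos[OF assms]
  by (simp add: gel_rate_eq[OF assms] power2_eq_square field_simps)

lemma gel_rate_has_integral:
  assumes "before_gel t"
  shows "(gel_rate S G lam has_integral inverse (M2 0) - inverse (M2 t)) {0..t}"
proof -
  have "(gel_rate S G lam has_integral - inverse (M2 t) - - inverse (M2 0)) {0..t}"
  proof (rule fundamental_theorem_of_calculus)
    fix s assume "s \<in> {0..t}"
    then show "((\<lambda>s. - inverse (M2 s)) has_vector_derivative gel_rate S G lam s) (at s within {0..t})"
      using DERIV_subset[OF inverse_M2_deriv[OF before_gel_mono[OF assms]], of s "{0..t}"]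
      by (auto simp: has_real_derivative_iff_has_vector_derivative)
  qed (use assms in \<open>simp add: before_gel_def\<close>)
  then show ?thesis by simp
qed

text \<open>The blow-up is given in \<open>ennreal\<close>, while \<open>enn2real\<close> sends
  infinity to 0. It transfers to \<open>M2\<close> because the moment is finite at times before
  \<open>T\<close>. For negative \<open>Z\<close>, positivity of \<open>M2\<close> suffices.\<close>

lemma M2_at_gel:
  assumes gel: "gel_time S lam = ereal T" and T: "0 < T"
  shows "filterlim M2 at_top (at_left T)"
  unfolding filterlim_at_top_dense
proof
  fix Z
  have "((\<lambda>t. total_moment S lam 2 t) \<longlongrightarrow> \<infinity>) (at_left T)"
    using solution gel by (simp add: coag_solution_def)
  then have "\<forall>\<^sub>F t in at_left T. ennreal Z < total_moment S lam 2 t"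
    by (rule order_tendstoD) simp
  moreover have "\<forall>\<^sub>F t in at_left T. t \<in> {0<..<T}"
    by (rule eventually_at_left_real[OF T])
  ultimately show "\<forall>\<^sub>F t in at_left T. Z < M2 t"
  proof eventually_elim
    case (elim t)
    then have "before_gel t"
      by (simp add: before_gel_def gel)
    then have "total_moment S lam 2 t = ennreal (M2 t)"
      using total_moment_finite by (simp add: M2_def)
    then show ?case
      using elim(1) M2_pos[OF \<open>before_gel t\<close>] by (cases "Z \<ge> 0") (auto simp: ennreal_less_iff)
  qed
qed

lemma gel_rate_has_integral_gel:
  assumes gel: "gel_time S lam = ereal T"
  shows "(gel_rate S G lam has_integral inverse (M2 0)) {0..T}"
proof -
  have T: "0 < T"
    using before_gel_0 gel by (simp add: before_gel_def)
  have pre: "before_gel t" if "0 \<le> t" "t < T" for t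
    using that by (simp add: before_gel_def gel)
  \<comment> \<open>At \<open>T\<close> the antiderivative gets its left limit 0, whatever the value
    of \<open>M2 T\<close>.\<close>
  define F where "F t = (if t < T then - inverse (M2 t) else 0)" for t
  have deriv: "(F has_real_derivative gel_rate S G lam t) (at t within {0..})" if "0 \<le> t" "t < T" for t
  proof (rule has_field_derivative_transform_within[OF inverse_M2_deriv[OF pre[OF that]]])
    show "0 < T - t" "t \<in> {0..}"
      using that by auto
    show "- inverse (M2 s) = F s" if "s \<in> {0..}" "dist s t < T - t" for s
      using that by (auto simp: F_def dist_real_def)
  qed
  have deriv_at: "(F has_real_derivative gel_rate S G lam t) (at t)" if "0 < t" "t < T" for t
    using deriv[of t] that by (simp add: at_within_interior[of t "{0..}"])
  \<comment> \<open>This form of the fundamental theorem needs continuity on the closed interval but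
    derivatives only inside, so \<open>gel_rate\<close> at \<open>T\<close> may be
    arbitrary.\<close>
  have "(gel_rate S G lam has_integral F T - F 0) {0..T}"
  proof (rule fundamental_theorem_of_calculus_interior)
    show "continuous_on {0..T} F"
    proof (rule continuous_on_IccI)
      show "(F \<longlongrightarrow> F 0) (at_right 0)"
        using deriv[of 0] T by (auto dest!: DERIV_continuous simp: continuous_within
            intro: tendsto_within_subset)
      show "(F \<longlongrightarrow> F t) (at t)" if "0 < t" "t < T" for t
        using DERIV_isCont[OF deriv_at[OF that]] by (simp add: isCont_def)
      have "((\<lambda>t. - inverse (M2 t)) \<longlongrightarrow> - 0) (at_left T)"
        by (intro tendsto_minus tendsto_inverse_0_at_top M2_at_gel gel T)
      then have "(F \<longlongrightarrow> - 0) (at_left T)"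
        by (rule Lim_transform_eventually)
           (use eventually_at_left_real[OF T] in \<open>eventually_elim, simp add: F_def\<close>)
      then show "(F \<longlongrightarrow> F T) (at_left T)"
        by (simp add: F_def)
    qed (fact T)
  qed (use T deriv_at in \<open>auto simp: has_real_derivative_iff_has_vector_derivative\<close>)
  then show ?thesis
    using T by (simp add: F_def)
qed

text \<open>Before gelation the integral is \<open>inverse (M2 0) - inverse (M2 t)\<close>, strictly
  below the threshold. Hence the set contains at most the gelation time itself, and it does contain
  it when that time is finite. The restriction \<open>ereal t \<le> gel_time S lam\<close> keeps the
  integral where \<alpha> is meaningful.\<close>

lemma gel_time_eq:
  "gel_time S lam = Inf {ereal t | t. 0 < t \<and> ereal t \<le> gel_time S lam \<and>
     (gel_rate S G lam has_integral inverse (M2 0)) {0..t}}"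
  (is "_ = Inf ?A")
proof -
  have at_gel: "gel_time S lam = ereal t"
    if "0 < t" "ereal t \<le> gel_time S lam"
      "(gel_rate S G lam has_integral inverse (M2 0)) {0..t}" for t
  proof (rule ccontr)
    assume "gel_time S lam \<noteq> ereal t"
    with that have "before_gel t"
      by (auto simp: before_gel_def)
    from has_integral_unique[OF gel_rate_has_integral[OF this] that(3)] M2_pos[OF this]
    show False by simp
  qed
  show ?thesis
  proof (cases "gel_time S lam")
    case (real T)
    then have "0 < T"
      using before_gel_0 by (simp add: before_gel_def)
    then have "?A = {ereal T}"
      using real at_gel gel_rate_has_integral_gel[OF real] by auto
    then show ?thesis
      using real by simp
  next
    case PInf
    then have "?A = {}"
      using at_gel by auto
    \<comment> \<open>The infimum of the empty set is the top element of \<open>ereal\<close>, as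
      the convention in the claim demands.\<close>
    then have "Inf ?A = \<infinity>"
      by (simp only: Inf_empty top_ereal_def)
    then show ?thesis
      using PInf by simp
  next
    case MInf
    then show ?thesis
      using before_gel_0 by (simp add: before_gel_def)
  qed
qed

end

end

theorem theorem3p3:
  fixes S :: "'s set"
    and G :: "'s \<Rightarrow> 's \<Rightarrow> real"
    and lam :: "real \<Rightarrow> nat \<Rightarrow> 's \<Rightarrow> real"
    and T1 :: real
  assumes "countable S"
    and "bounded_kernel S G"
    and "coag_solution S G lam"
    and "monodisperse_initial S lam"
    and "0 < T1" and "ereal T1 \<le> gel_time S lam"
    and A1: "moment_control S G lam T1 1"
    and A2: "moment_control S G lam T1 2"
  shows "(\<forall>t\<ge>0. ereal t < gel_time S lam \<longrightarrow>
            0 < total_moment S lam 2 t \<and> total_moment S lam 2 t < \<infinity> \<and>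
            ((\<lambda>s. enn2real (total_moment S lam 2 s)) has_real_derivative
               gel_rate S G lam t * (enn2real (total_moment S lam 2 t))\<^sup>2) (at t within {0..}))
       \<and> gel_time S lam =
           Inf {ereal t | t. 0 < t \<and> ereal t \<le> gel_time S lam \<and>
                  (gel_rate S G lam has_integral inverse (enn2real (total_moment S lam 2 0))) {0..t}}"
proof -
  obtain C where C: "\<forall>x\<in>S. \<forall>y\<in>S. G x y \<le> C" and G: "\<forall>x\<in>S. \<forall>y\<in>S. 0 < G x y"
    using assms(2) unfolding bounded_kernel_def by blast
  interpret spatial_coagulation S G lam C
    by unfold_locales (use C G assms(3) in auto)
  have pos: "0 < M2 0"
    using M2_initial[OF assms(4)] by simp
  show ?thesis
    unfolding M2_def[symmetric]
  proof (intro conjI allI impI)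
    fix t :: real assume "0 \<le> t" "ereal t < gel_time S lam"
    then have t: "before_gel t"
      by (simp add: before_gel_def)
    show "0 < total_moment S lam 2 t"
      using M2_pos[OF pos t] by (simp add: M2_def enn2real_positive_iff)
    show "total_moment S lam 2 t < \<infinity>"
      by (rule total_moment_finite[OF t])
    show "((\<lambda>s. M2 s) has_real_derivative gel_rate S G lam t * (M2 t)\<^sup>2) (at t within {0..})"
      using M2_deriv[OF t] M2_pos[OF pos t] by (simp add: gel_rate_eq[OF t])
  qed (rule gel_time_eq[OF pos])
qed

end
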